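(* If $M(0,\infty)<\infty$, then $D<\infty$ almost surely. Otherwise (that is, if $M(0,\infty)=\infty$), let \[ I=\int_0^\infty \mathrm{e}^{-M(t,t+\ell)}\,\mu(t)\,\mathrm{d}t . \] Then $D<\infty$ almost surely if $I=\infty$, and $\mathbb{P}(D=\infty)>0$ if $I<\infty$.
   Context: Let $\ell>0$ be fixed. $\mathcal N$ is an inhomogeneous Poisson point process on $(0,\infty)$ with rate function $\mu(t)$, i.e. with intensity measure $\mu(t)\,\mathrm{d}t$; write $M(a,b)=\int_a^b\mu(t)\,\mathrm{d}t$. It is assumed that $M(0,t)<\infty$ for every finite $t$ and that $\mu(t)>0$ for Lebesgue-almost all $t\ge 0$. Let $0<T_1<T_2<\cdots$ be the epochs (points) of $\mathcal N$, with $T_0=0$ by convention; if $\mathcal N$ has only finitely many points, say $n$ of them, then $T_{n+1}=\infty$. Define $D=\min\{T_n:\ n\ge 0,\ T_{n+1}-T_n\ge \ell\}$, with $D=\infty$ if there is no such $n$. *)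

theory Defs
  imports "HOL-Probability.Probability"
begin

definition cumulative_rate :: "(real \<Rightarrow> real) \<Rightarrow> ereal \<Rightarrow> ereal \<Rightarrow> ennreal" where
  "cumulative_rate \<mu> a b = (\<integral>\<^sup>+ t \<in> einterval a b. ennreal (\<mu> t) \<partial>lborel)"

definition intensity_measure :: "(real \<Rightarrow> real) \<Rightarrow> real measure" where
  "intensity_measure \<mu> = density (restrict_space lborel {0<..}) (\<lambda>t. ennreal (\<mu> t))"

definition count_in :: "real set \<Rightarrow> real set \<Rightarrow> ennreal" where
  "count_in X A = emeasure (count_space UNIV) (X \<inter> A)"

(* A simple point process is represented as a random set of points.  Finiteness of the set
   below every t is what makes it possible to list the points in increasing order.
   The Poisson law is spelled out instead of using poisson_pmf, which is only specified for
   a strictly positive rate; the Poisson law with infinite mean is the point mass at infinity. *)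
definition poisson_point_process ::
    "'w measure \<Rightarrow> ('w \<Rightarrow> real set) \<Rightarrow> (real \<Rightarrow> real) \<Rightarrow> bool" where
  "poisson_point_process P N \<mu> \<longleftrightarrow>
     prob_space P \<and>
     (\<forall>\<omega>\<in>space P. N \<omega> \<subseteq> {0<..} \<and> (\<forall>t. finite (N \<omega> \<inter> {..t}))) \<and>
     (\<forall>A\<in>sets (intensity_measure \<mu>). (\<lambda>\<omega>. count_in (N \<omega>) A) \<in> borel_measurable P) \<and>
     (\<forall>A\<in>sets (intensity_measure \<mu>). emeasure (intensity_measure \<mu>) A < \<infinity> \<longrightarrow>
        (\<forall>k::nat. measure P {\<omega>\<in>space P. count_in (N \<omega>) A = of_nat k} =
           measure (intensity_measure \<mu>) A ^ k / fact k * exp (- measure (intensity_measure \<mu>) A))) \<and>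
     (\<forall>A\<in>sets (intensity_measure \<mu>). emeasure (intensity_measure \<mu>) A = \<infinity> \<longrightarrow>
        (AE \<omega> in P. count_in (N \<omega>) A = \<infinity>)) \<and>
     (\<forall>(n::nat) A. A ` {..<n} \<subseteq> sets (intensity_measure \<mu>) \<and> disjoint_family_on A {..<n} \<longrightarrow>
        prob_space.indep_vars P (\<lambda>_. borel) (\<lambda>i \<omega>. count_in (N \<omega>) (A i)) {..<n})"

(* Inf {} = \<infinity> in ereal, so epoch X (n + 1) = \<infinity> if X has exactly n points. *)
primrec epoch :: "real set \<Rightarrow> nat \<Rightarrow> ereal" where
  "epoch X 0 = 0"
| "epoch X (Suc n) = Inf {ereal x | x. x \<in> X \<and> epoch X n < ereal x}"

(* The epochs increase with n, so the infimum is a minimum whenever the set is nonempty;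
   for the empty set it is \<infinity>.  The condition epoch X n < \<infinity> restricts to the indices n
   for which T_n and T_{n+1} are defined in the usual convention. *)
definition first_gap :: "real \<Rightarrow> real set \<Rightarrow> ereal" where
  "first_gap l X =
     Inf {epoch X n | n. epoch X n < \<infinity> \<and> ereal l \<le> epoch X (Suc n) - epoch X n}"

(* Only used where cumulative_rate is finite on bounded intervals, so enn2real loses nothing. *)
definition gap_integral :: "real \<Rightarrow> (real \<Rightarrow> real) \<Rightarrow> ennreal" where
  "gap_integral l \<mu> =
     (\<integral>\<^sup>+ t \<in> {0<..}. ennreal (exp (- enn2real (cumulative_rate \<mu> (ereal t) (ereal (t + l)))) * \<mu> t) \<partial>lborel)"

end

theory Submission
  imports Defs
begin

text \<open>Write \<open>X\<close> for the random set of points and \<open>\<Lambda>\<close> for its intensity measure.  The event \<open>D = \<infinity>\<close> says that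
every open window \<open>(s, s + l)\<close> with \<open>s \<ge> 0\<close> meets \<open>X\<close> (\<open>first_gap_eq_infinity_iff\<close>).  In this form it is
an increasing event expressed by void events, whose probabilities
\<open>P(X \<inter> A = {}) = exp (- \<Lambda> A)\<close> multiply over disjoint sets.

If \<open>\<Lambda>\<close> is finite on \<open>(0, \<infinity>)\<close>, far windows are void with probability close to \<open>1\<close>
(\<open>covered_null_finite\<close>).  Otherwise the half-line is cut into cells on which \<open>\<Lambda>(t, t + l]\<close> is constant up
to an error of \<open>1\<close> (\<open>cells_exist\<close>), so that the probability that a gap starts in a cell is comparable with the
contribution of the cell to \<open>I\<close> (\<open>gap_intensity_le\<close>, \<open>gap_intensity_ge\<close>).

If \<open>I = \<infinity>\<close>, let \<open>q = P(D = \<infinity>)\<close>.  A process with no gap at all has in particular no gap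
before a given cell, and by the positive correlation of increasing events (\<open>covered_hit_correlation\<close>) it does so and
hits the cell with probability at least \<open>q\<close> times the probability of a hit.  The void window that follows is independent
of this, so the cell is the first one to be hit and followed by a void window with probability at least
a constant times \<open>q\<close> times its contribution to \<open>I\<close>.  These events are disjoint for different cells, hence \<open>q I\<close> is bounded
and \<open>q = 0\<close> (\<open>covered_null_infinite\<close>).

If \<open>I < \<infinity>\<close>, the union bound over the cells beyond a far point \<open>a\<close> shows that gaps starting beyond
\<open>a\<close> are unlikely, and with positive probability, independently, the points up to \<open>a\<close> leave no gap before \<open>a\<close>.
The joint at \<open>a\<close> needs a point soon after it: \<open>a\<close> is chosen with mass at least \<open>1/2\<close> in \<open>(a, a + l/2]\<close>,
and such \<open>a\<close> exist arbitrarily far out because \<open>I\<close> would be infinite otherwise (\<open>covered_positive\<close>).\<close>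

section \<open>Gaps and empty windows\<close>

lemma epoch_nonneg: "0 \<le> epoch X n"
proof (induction n)
  case (Suc n)
  then have "0 \<le> ereal x" if "epoch X n < ereal x" for x
    using that by (rule order.trans[OF _ less_imp_le])
  then show ?case by (auto intro!: Inf_greatest)
qed simp

text \<open>Local finiteness turns the infimum in \<open>epoch\<close> into a minimum, so that finite epochs are points.\<close>
lemma epoch_Suc_attained:
  assumes fin: "\<And>t. finite (X \<inter> {..t})" and lt: "epoch X (Suc n) < \<infinity>"
  obtains x where "x \<in> X" "epoch X (Suc n) = ereal x" "epoch X n < ereal x"
proof -
  let ?S = "{x \<in> X. epoch X n < ereal x}"
  have eq: "epoch X (Suc n) = Inf (ereal ` ?S)"
    by (auto intro!: arg_cong[where f=Inf])
  have "?S \<noteq> {}"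
  proof
    assume "?S = {}"
    with lt show False unfolding eq by (simp only: image_empty Inf_empty top_ereal_def less_irrefl)
  qed
  then obtain y where y: "y \<in> ?S" by blast
  let ?F = "?S \<inter> {..y}"
  have F: "finite ?F" "?F \<noteq> {}" using y by (auto intro: finite_subset[OF _ fin[of y]])
  define x where "x = Min ?F"
  have x: "x \<in> ?F" unfolding x_def by (rule Min_in[OF F])
  have "x \<le> z" if "z \<in> ?S" for z
    using that x F by (cases "z \<le> y") (auto simp: x_def)
  then have "Inf (ereal ` ?S) = ereal x"
    using x by (intro Inf_eqI) auto
  with eq x show ?thesis by (intro that[of x]) auto
qed

text \<open>The window form of the event \<open>D = \<infinity>\<close>.  If no gap reaches length \<open>l\<close>, then for \<open>s\<close> between
  two consecutive epochs the next epoch lies less than \<open>l\<close> above \<open>s\<close>; conversely the window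
  opened at \<open>s = T\<^sub>n\<close> catches \<open>T\<^sub>n\<^sub>+\<^sub>1\<close>.  Open windows are the right ones because a gap of length exactly
  \<open>l\<close> already stops the process.\<close>
lemma first_gap_eq_infinity_iff:
  assumes fin: "\<And>t. finite (X \<inter> {..t})" and l: "0 < l"
  shows "first_gap l X = \<infinity> \<longleftrightarrow> (\<forall>s\<ge>0. X \<inter> {s<..<s + l} \<noteq> {})"
proof
  assume inf: "first_gap l X = \<infinity>"
  have step: "epoch X (Suc n) - epoch X n < ereal l" if "epoch X n < \<infinity>" for n
  proof (rule ccontr)
    assume "\<not> ?thesis"
    then have "first_gap l X \<le> epoch X n"
      unfolding first_gap_def using that by (intro Inf_lower) (auto simp: not_less)
    with inf that show False by simp
  qed
  have finite_epoch: "epoch X n < \<infinity>" for n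
  proof (induction n)
    case (Suc n)
    then show ?case using step[OF Suc] epoch_nonneg[of X n]
      by (cases "epoch X n"; cases "epoch X (Suc n)") auto
  qed simp
  define T where "T n = real_of_ereal (epoch X n)" for n
  have T: "epoch X n = ereal (T n)" for n
    using finite_epoch[of n] epoch_nonneg[of X n] unfolding T_def by (cases "epoch X n") auto
  have T0: "T 0 = 0" by (simp add: T_def)
  have T_Suc: "T (Suc n) \<in> X \<and> T n < T (Suc n) \<and> T (Suc n) < T n + l" for n
  proof -
    obtain x where x: "x \<in> X" "epoch X (Suc n) = ereal x" "epoch X n < ereal x"
      by (rule epoch_Suc_attained[OF fin finite_epoch[of "Suc n"]])
    then have "x = T (Suc n)" using T[of "Suc n"] by simp
    with x T step[OF finite_epoch[of n]] show ?thesis by auto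
  qed
  have mono: "strict_mono T" using T_Suc by (simp add: strict_mono_Suc_iff)
  show "\<forall>s\<ge>0. X \<inter> {s<..<s + l} \<noteq> {}"
  proof (intro allI impI)
    fix s :: real assume s: "0 \<le> s"
    \<comment> \<open>Local finiteness makes the epochs exceed every bound.\<close>
    have "\<exists>n. s < T n"
    proof (rule ccontr)
      assume "\<not> ?thesis"
      then have "(\<lambda>n. T (Suc n)) ` UNIV \<subseteq> X \<inter> {..s}" using T_Suc by (auto simp: not_less)
      then have "finite (range (\<lambda>n. T (Suc n)))" using fin finite_subset by blast
      moreover have "inj (\<lambda>n. T (Suc n))"
        using strict_mono_eq[OF mono] by (simp add: inj_def)
      ultimately show False using finite_imageD by blast
    qed
    then have n: "s < T (LEAST n. s < T n)" by (rule LeastI_ex)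
    then obtain m where m: "(LEAST n. s < T n) = Suc m"
      using s T0 by (cases "LEAST n. s < T n") auto
    then have "\<not> s < T m" by (metis lessI not_less_Least)
    then show "X \<inter> {s<..<s + l} \<noteq> {}" using n m T_Suc[of m] by auto
  qed
next
  assume hit: "\<forall>s\<ge>0. X \<inter> {s<..<s + l} \<noteq> {}"
  have "\<not> ereal l \<le> epoch X (Suc n) - epoch X n" if lt: "epoch X n < \<infinity>" for n
  proof -
    obtain s where s: "epoch X n = ereal s" "0 \<le> s"
      using lt epoch_nonneg[of X n] by (cases "epoch X n") auto
    then obtain x where x: "x \<in> X" "s < x" "x < s + l" using hit by force
    have "epoch X (Suc n) \<le> ereal x" using x s by (auto intro!: Inf_lower)
    then show ?thesis using s x epoch_nonneg[of X "Suc n"]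
      by (cases "epoch X (Suc n)") auto
  qed
  then have "{epoch X n |n. epoch X n < \<infinity> \<and> ereal l \<le> epoch X (Suc n) - epoch X n} = {}"
    by auto
  then show "first_gap l X = \<infinity>"
    by (simp only: first_gap_def Inf_empty top_ereal_def)
qed

text \<open>Measurability of the window event needs countably many windows.  Shrinking a window by \<open>1 / (k + 1)\<close>
  makes room to move its left end to a rational; in the other direction the left ends stay in the
  compact interval \<open>[0, m]\<close> and a limit point of them is the left end of an empty window of full length.\<close>
lemma empty_window_iff:
  fixes X :: "real set"
  assumes l: "0 < l"
  shows "(\<exists>s\<ge>0. X \<inter> {s<..<s + l} = {}) \<longleftrightarrow>
    (\<exists>m::nat. \<forall>k::nat. \<exists>r\<in>\<rat> \<inter> {0..real m}. X \<inter> {r<..<r + l - 1 / real (Suc k)} = {})"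
    (is "?L \<longleftrightarrow> ?R")
proof
  assume ?L
  then obtain s where s: "0 \<le> s" "X \<inter> {s<..<s + l} = {}" by blast
  obtain m :: nat where m: "s + 1 \<le> real m" using real_arch_simple by blast
  have "\<exists>r\<in>\<rat> \<inter> {0..real m}. X \<inter> {r<..<r + l - 1 / real (Suc k)} = {}" for k
  proof -
    obtain r where r: "r \<in> \<rat>" "s < r" "r < s + 1 / real (Suc k)"
      using Rats_dense_in_real[of s "s + 1 / real (Suc k)"] by auto
    have "1 / real (Suc k) \<le> 1" by simp
    then have "r \<in> {0..real m}" using r s m unfolding atLeastAtMost_iff by linarith
    moreover have "{r<..<r + l - 1 / real (Suc k)} \<subseteq> {s<..<s + l}" using r by auto
    ultimately show ?thesis using r s by blast
  qed
  then show ?R by blast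
next
  assume ?R
  then obtain m :: nat where
    "\<forall>k::nat. \<exists>r\<in>\<rat> \<inter> {0..real m}. X \<inter> {r<..<r + l - 1 / real (Suc k)} = {}" by blast
  then obtain r where r: "\<And>k::nat. r k \<in> {0..real m}"
      "\<And>k. X \<inter> {r k<..<r k + l - 1 / real (Suc k)} = {}" by (metis Int_iff)
  have sc: "seq_compact {0..real m}" by (simp add: compact_imp_seq_compact)
  then obtain s \<phi> where s: "s \<in> {0..real m}" "strict_mono (\<phi> :: nat \<Rightarrow> nat)" "(r \<circ> \<phi>) \<longlonglongrightarrow> s"
    using seq_compactE[OF sc, of r] r(1) by blast
  have "(\<lambda>k. 1 / real (Suc k)) \<longlonglongrightarrow> 0" by (rule lim_1_over_n[THEN LIMSEQ_Suc])
  then have inv: "(\<lambda>k. 1 / real (Suc (\<phi> k))) \<longlonglongrightarrow> 0"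
    using LIMSEQ_subseq_LIMSEQ[OF _ s(2)] by (force simp: o_def)
  have "x \<notin> X" if x: "s < x" "x < s + l" for x
  proof
    assume "x \<in> X"
    have "(\<lambda>k. (r \<circ> \<phi>) k + l - 1 / real (Suc (\<phi> k))) \<longlonglongrightarrow> s + l - 0"
      by (intro tendsto_intros s inv)
    then have "\<forall>\<^sub>F k in sequentially. x < (r \<circ> \<phi>) k + l - 1 / real (Suc (\<phi> k))"
      using x by (intro order_tendstoD(1)) auto
    moreover have "\<forall>\<^sub>F k in sequentially. (r \<circ> \<phi>) k < x" using s(3) x by (intro order_tendstoD(2))
    ultimately have "\<forall>\<^sub>F k in sequentially. False"
      by eventually_elim (use r(2) \<open>x \<in> X\<close> in fastforce)
    then show False by simp
  qed
  then show ?L using s(1) by (intro exI[of _ s]) auto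
qed

section \<open>Diffuse intensities and cells\<close>

text \<open>The role of \<open>\<mu>(t) dt\<close>: finiteness on bounded sets makes void probabilities positive, and the absence
  of atoms makes the distribution function continuous, so that it can be cut at prescribed levels.\<close>
locale diffuse_intensity =
  fixes \<Lambda> :: "real measure"
  assumes sets_intensity [simp, measurable_cong]: "sets \<Lambda> = sets borel"
    and finite_below: "emeasure \<Lambda> {..t} < \<infinity>"
    and diffuse: "emeasure \<Lambda> {t} = 0"
begin

lemma space_intensity [simp]: "space \<Lambda> = UNIV"
  using sets_eq_imp_space_eq[OF sets_intensity] by simp

lemma fmeasurable_bounded [simp]:
  assumes "A \<in> sets borel" "bounded A"
  shows "A \<in> fmeasurable \<Lambda>"
proof -
  obtain b where "\<And>x. x \<in> A \<Longrightarrow> norm x \<le> b" using assms(2) unfolding bounded_iff by blast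
  then have "A \<subseteq> {..b}" by force
  then have "emeasure \<Lambda> A \<le> emeasure \<Lambda> {..b}" by (intro emeasure_mono) auto
  also have "\<dots> < \<infinity>" by (rule finite_below)
  finally show ?thesis using assms(1) by (intro fmeasurableI) auto
qed

lemma emeasure_bounded:
  "A \<in> sets borel \<Longrightarrow> bounded A \<Longrightarrow> emeasure \<Lambda> A = ennreal (measure \<Lambda> A)"
  using fmeasurable_bounded[of A] by (simp add: fmeasurable_def emeasure_eq_ennreal_measure)

lemma fmeasurable_atMost [simp]: "{..t} \<in> fmeasurable \<Lambda>"
  using finite_below by (intro fmeasurableI) auto

lemma measure_Ioc:
  assumes "a \<le> b" shows "measure \<Lambda> {a<..b} = cdf \<Lambda> b - cdf \<Lambda> a"
proof -
  have "{a<..b} = {..b} - {..a}" by auto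
  moreover have "measure \<Lambda> ({..b} - {..a}) = measure \<Lambda> {..b} - measure \<Lambda> {..a}"
    using assms fmeasurableD2[OF fmeasurable_atMost] by (intro measure_Diff) auto
  ultimately show ?thesis by (simp add: cdf_def)
qed

lemma cdf_mono: "mono (cdf \<Lambda>)"
  unfolding cdf_def by (intro monoI measure_mono_fmeasurable) auto

text \<open>Continuity is local: removing the mass above \<open>x + 1\<close> leaves a finite measure whose distribution
  function agrees with that of \<open>\<Lambda>\<close> near \<open>x\<close>.\<close>
lemma isCont_cdf_intensity: "isCont (cdf \<Lambda>) x"
proof -
  define \<Lambda>' where "\<Lambda>' = density \<Lambda> (indicator {..x + 1})"
  have em: "emeasure \<Lambda>' A = emeasure \<Lambda> ({..x + 1} \<inter> A)" if "A \<in> sets borel" for A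
    using that unfolding \<Lambda>'_def by (subst emeasure_density)
      (auto simp: indicator_inter_arith[symmetric] intro!: nn_integral_cong)
  have "space \<Lambda>' = UNIV" "sets \<Lambda>' = sets borel" by (simp_all add: \<Lambda>'_def)
  moreover from this have "emeasure \<Lambda>' (space \<Lambda>') \<noteq> \<infinity>"
    using finite_below[of "x + 1"] by (simp add: em)
  ultimately interpret finite_borel_measure \<Lambda>'
    by (intro finite_borel_measure.intro finite_borel_measure_axioms.intro finite_measureI)
  have "emeasure \<Lambda>' {x} \<le> emeasure \<Lambda> {x}" by (subst em) (auto intro!: emeasure_mono)
  then have "isCont (cdf \<Lambda>') x"
    unfolding isCont_cdf by (simp add: diffuse measure_def)
  moreover have "\<forall>\<^sub>F y in nhds x. cdf \<Lambda>' y = cdf \<Lambda> y"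
  proof -
    have "\<forall>\<^sub>F y in nhds x. y \<in> {..<x + 1}" by (intro eventually_nhds_in_open) auto
    then show ?thesis
    proof eventually_elim
      case (elim y)
      then have "{..x + 1} \<inter> {..y} = {..y}" by auto
      then show ?case by (simp add: cdf_def measure_def em)
    qed
  qed
  ultimately show ?thesis by (simp add: isCont_cong)
qed

lemma cdf_unbounded:
  assumes "emeasure \<Lambda> {0<..} = \<infinity>"
  shows "\<exists>t\<ge>a. K \<le> cdf \<Lambda> t"
proof (rule ccontr)
  assume neg: "\<not> ?thesis"
  have "cdf \<Lambda> (real n) \<le> \<bar>K\<bar>" for n
    using neg[unfolded not_ex, rule_format, of "max a (real n)"] monoD[OF cdf_mono, of "real n" "max a (real n)"]
    by auto
  then have le: "emeasure \<Lambda> {..real n} \<le> ennreal \<bar>K\<bar>" for n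
    using fmeasurable_atMost[of "real n"]
    by (simp add: cdf_def fmeasurable_def emeasure_eq_ennreal_measure del: fmeasurable_atMost)
  have "(\<Union>n. {..real n}) = UNIV" using real_arch_simple by auto
  moreover have "(SUP n. emeasure \<Lambda> {..real n}) = emeasure \<Lambda> (\<Union>n. {..real n})"
    by (intro SUP_emeasure_incseq) (auto simp: incseq_def)
  ultimately have "emeasure \<Lambda> UNIV \<le> ennreal \<bar>K\<bar>" using le by (metis SUP_least)
  moreover have "emeasure \<Lambda> {0<..} \<le> emeasure \<Lambda> UNIV" by (intro emeasure_mono) auto
  ultimately show False using assms by (auto simp: top_unique)
qed

text \<open>The points \<open>c\<close> cut \<open>(a, \<infinity>)\<close> into cells so short that neither a cell nor its translate by \<open>l\<close> has
  mass above \<open>1\<close>.  Then \<open>\<Lambda>(t, t + l]\<close> varies by at most \<open>1\<close> while \<open>t\<close> runs through a cell, and the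
  gap integrand may be replaced by a constant there at the cost of a factor \<open>e\<close>.\<close>
definition cells :: "real \<Rightarrow> real \<Rightarrow> (nat \<Rightarrow> real) \<Rightarrow> bool" where
  "cells l a c \<longleftrightarrow> c 0 = a \<and> strict_mono c \<and> (\<forall>t. \<exists>i. t \<le> c i) \<and>
     (\<forall>i. measure \<Lambda> {c i<..c (Suc i)} + measure \<Lambda> {c i + l<..c (Suc i) + l} \<le> 1)"

text \<open>The cut points are the places where the continuous increasing function
  \<open>G(t) = \<Lambda>(-\<infinity>, t] + \<Lambda>(-\<infinity>, t + l]\<close> has grown by \<open>0, 1, 2, \<dots>\<close> since \<open>a\<close>; they tend to infinity
  because \<open>G\<close> is finite at every point.\<close>
lemma cells_exist:
  assumes inf: "emeasure \<Lambda> {0<..} = \<infinity>" and l: "0 < l"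
  obtains c where "cells l a c"
proof -
  define G where "G t = cdf \<Lambda> t + cdf \<Lambda> (t + l)" for t
  have mono: "mono G" unfolding G_def by (intro monoI add_mono monoD[OF cdf_mono]) auto
  have cont: "isCont G t" for t
    unfolding G_def by (intro continuous_intros isCont_cdf_intensity isCont_o2[where g="cdf \<Lambda>"])
  have "\<exists>t\<ge>a. G t = G a + real i" for i :: nat
  proof -
    obtain b where "b \<ge> a" "G a + real i \<le> cdf \<Lambda> b" using cdf_unbounded[OF inf] by blast
    moreover have "0 \<le> cdf \<Lambda> (b + l)" by (simp add: cdf_def)
    ultimately have "G a + real i \<le> G b" unfolding G_def[of b] by linarith
    moreover have "continuous_on {a..b} G" using cont by (simp add: continuous_at_imp_continuous_on)
    ultimately show ?thesis using IVT'[of G a "G a + real i" b] \<open>b \<ge> a\<close> by auto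
  qed
  then obtain c' where c': "\<And>i. c' i \<ge> a" "\<And>i. G (c' i) = G a + real i" by metis
  \<comment> \<open>\<open>G\<close> may be constant to the right of \<open>a\<close>, so the choice above need not give \<open>a\<close> for \<open>i = 0\<close>.\<close>
  define c where "c i = (if i = 0 then a else c' i)" for i
  have c: "G (c i) = G a + real i" for i by (simp add: c_def c')
  have less: "c i < c (Suc i)" for i
    using monoD[OF mono, of "c (Suc i)" "c i"] c[of i] c[of "Suc i"] by (cases "c i < c (Suc i)") auto
  have "\<exists>i. t \<le> c i" for t
  proof -
    have "0 \<le> G a" by (simp add: G_def cdf_def)
    obtain i :: nat where "G t < real i" using reals_Archimedean2 by blast
    with \<open>0 \<le> G a\<close> have "G t < G (c i)" by (simp add: c)
    then have "t \<le> c i" using monoD[OF mono, of "c i" t] by force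
    then show ?thesis ..
  qed
  moreover have "measure \<Lambda> {c i<..c (Suc i)} + measure \<Lambda> {c i + l<..c (Suc i) + l} \<le> 1" for i
    using less[of i] c[of i] c[of "Suc i"] by (simp add: measure_Ioc G_def)
  ultimately have "cells l a c"
    using less by (simp add: cells_def strict_mono_Suc_iff c_def)
  then show ?thesis by (rule that)
qed

lemma cells_cover:
  assumes "cells l a c" "a < t"
  obtains i where "c i < t" "t \<le> c (Suc i)"
proof -
  have ex: "\<exists>i. t \<le> c i" using assms by (simp add: cells_def)
  have "t \<le> c (LEAST i. t \<le> c i)" using ex by (rule LeastI_ex)
  moreover obtain m where m: "(LEAST i. t \<le> c i) = Suc m"
    using assms calculation by (cases "LEAST i. t \<le> c i") (auto simp: cells_def)
  moreover have "\<not> t \<le> c m" using m by (metis lessI not_less_Least)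
  ultimately show ?thesis by (intro that[of m]) auto
qed

lemma cells_UN:
  assumes "cells l a c" shows "(\<Union>i. {c i<..c (Suc i)}) = {a<..}"
proof -
  have "a \<le> c i" for i
    using assms strict_mono_less_eq[of c 0 i] by (auto simp: cells_def)
  then have "{c i<..c (Suc i)} \<subseteq> {a<..}" for i by (intro subsetI) (auto intro: order.strict_trans1[of a "c i"])
  then have "(\<Union>i. {c i<..c (Suc i)}) \<subseteq> {a<..}" by blast
  moreover have "t \<in> (\<Union>i. {c i<..c (Suc i)})" if "a < t" for t
    using cells_cover[OF assms that] by auto
  ultimately show ?thesis by auto
qed

lemma cells_disjoint:
  assumes "cells l a c" shows "disjoint_family (\<lambda>i. {c i<..c (Suc i)})"
proof -
  have mono: "c (Suc i) \<le> c j" if "i < j" for i j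
    using assms that by (auto simp: cells_def strict_mono_less_eq)
  have "{c i<..c (Suc i)} \<inter> {c j<..c (Suc j)} = {}" if "i \<noteq> j" for i j
    using that mono[of i j] mono[of j i] by (cases "i < j") auto
  then show ?thesis by (auto simp: disjoint_family_on_def)
qed

end

section \<open>The gap intensity\<close>

lemma tail_emeasure_small:
  fixes M :: "real measure"
  assumes sets: "sets M = sets borel" and fin: "emeasure M {0<..} < \<infinity>" and \<epsilon>: "0 < \<epsilon>"
  obtains t where "0 < t" "emeasure M {t<..} < \<epsilon>"
proof -
  have "(\<lambda>n. emeasure M {real n<..}) \<longlonglongrightarrow> emeasure M (\<Inter>n. {real n<..})"
  proof (rule Lim_emeasure_decseq)
    show "emeasure M {real n<..} \<noteq> \<infinity>" for n
      using fin emeasure_mono[of "{real n<..}" "{0<..}" M] by (auto simp: sets top_unique)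
  qed (auto simp: sets decseq_def)
  moreover have "(\<Inter>n. {real n<..}) = {}" using reals_Archimedean2 by (fastforce dest: order.strict_trans)
  ultimately have "(\<lambda>n. emeasure M {real n<..}) \<longlonglongrightarrow> 0" by simp
  then have "\<forall>\<^sub>F n in sequentially. emeasure M {real n<..} < \<epsilon>"
    using \<epsilon> by (rule order_tendstoD)
  then have "\<forall>\<^sub>F n in sequentially. 0 < n \<and> emeasure M {real n<..} < \<epsilon>"
    using eventually_gt_at_top by (rule eventually_conj[rotated])
  then obtain n :: nat where "0 < n" "emeasure M {real n<..} < \<epsilon>"
    by (metis (mono_tags, lifting) eventually_happens' sequentially_bot)
  then show ?thesis by (intro that[of "real n"]) auto
qed

context diffuse_intensity
begin

text \<open>For a Poisson process the mass of \<open>A\<close> is the expected number of points in \<open>A\<close> that are followed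
  by a gap of length at least \<open>l\<close>;
  the total mass of \<open>(0, \<infinity>)\<close> is the integral \<open>I\<close>.\<close>
definition gap_intensity :: "real \<Rightarrow> real measure" where
  "gap_intensity l = density \<Lambda> (\<lambda>t. ennreal (exp (- measure \<Lambda> {t<..t + l})))"

lemma sets_gap_intensity [simp]: "sets (gap_intensity l) = sets borel"
  by (simp add: gap_intensity_def)

lemma cdf_measurable [measurable]: "cdf \<Lambda> \<in> borel_measurable borel"
  by (rule borel_measurable_mono[OF cdf_mono])

lemma window_measure_measurable [measurable]:
  assumes "0 < l" shows "(\<lambda>t. measure \<Lambda> {t<..t + l}) \<in> borel_measurable borel"
proof -
  have "(\<lambda>t. measure \<Lambda> {t<..t + l}) = (\<lambda>t. cdf \<Lambda> (t + l) - cdf \<Lambda> t)"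
    using assms by (simp add: measure_Ioc fun_eq_iff)
  then show ?thesis by simp
qed

lemma measure_mono_bounded:
  "A \<subseteq> B \<Longrightarrow> A \<in> sets borel \<Longrightarrow> B \<in> sets borel \<Longrightarrow> bounded B \<Longrightarrow> measure \<Lambda> A \<le> measure \<Lambda> B"
  by (rule measure_mono_fmeasurable) auto

lemma emeasure_gap_intensity:
  assumes "0 < l" "A \<in> sets borel"
  shows "emeasure (gap_intensity l) A =
    (\<integral>\<^sup>+t. ennreal (exp (- measure \<Lambda> {t<..t + l})) * indicator A t \<partial>\<Lambda>)"
  unfolding gap_intensity_def using assms
  by (subst emeasure_density) (auto intro!: measurable_compose[OF window_measure_measurable])

lemma nn_integral_const_bounded:
  assumes "A \<in> sets borel" "bounded A" "0 \<le> c"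
  shows "(\<integral>\<^sup>+t. ennreal c * indicator A t \<partial>\<Lambda>) = ennreal (measure \<Lambda> A * c)"
proof -
  have "(\<integral>\<^sup>+t. ennreal c * indicator A t \<partial>\<Lambda>) = ennreal c * emeasure \<Lambda> A"
    using assms by (intro nn_integral_cmult_indicator) auto
  then show ?thesis using assms by (simp add: emeasure_bounded ennreal_mult[symmetric] mult.commute)
qed

text \<open>For every \<open>t\<close> in \<open>(u, v]\<close> the window \<open>(t, t + l]\<close> contains \<open>(v, u + l]\<close>, and it exceeds it only by parts of
  \<open>(u, v]\<close> and \<open>(u + l, v + l]\<close>.  The two bounds below compare the integrand with its value for the
  common window; \<open>(v, u + l]\<close> is allowed to be empty.\<close>
lemma gap_intensity_le:
  assumes l: "0 < l"
  shows "emeasure (gap_intensity l) {u<..v} \<le>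
    ennreal (measure \<Lambda> {u<..v} * exp (- measure \<Lambda> {v<..u + l}))"
proof -
  have "emeasure (gap_intensity l) {u<..v} \<le>
      (\<integral>\<^sup>+t. ennreal (exp (- measure \<Lambda> {v<..u + l})) * indicator {u<..v} t \<partial>\<Lambda>)"
    unfolding emeasure_gap_intensity[OF l, of "{u<..v}", simplified]
    by (intro nn_integral_mono)
       (auto split: split_indicator intro!: ennreal_leI measure_mono_bounded)
  also have "\<dots> = ennreal (measure \<Lambda> {u<..v} * exp (- measure \<Lambda> {v<..u + l}))"
    by (simp add: nn_integral_const_bounded)
  finally show ?thesis .
qed

lemma gap_intensity_ge:
  assumes l: "0 < l" and small: "measure \<Lambda> {u<..v} + measure \<Lambda> {u + l<..v + l} \<le> 1"
  shows "ennreal (measure \<Lambda> {u<..v} * exp (- measure \<Lambda> {v<..u + l})) \<le>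
    ennreal (exp 1) * emeasure (gap_intensity l) {u<..v}"
proof -
  have "measure \<Lambda> {t<..t + l} \<le> measure \<Lambda> {v<..u + l} + 1" if "u < t" "t \<le> v" for t
  proof -
    have "measure \<Lambda> {t<..t + l} \<le> measure \<Lambda> ({v<..u + l} \<union> ({u<..v} \<union> {u + l<..v + l}))"
      using that by (intro measure_mono_bounded) auto
    also have "\<dots> \<le> measure \<Lambda> {v<..u + l} + measure \<Lambda> ({u<..v} \<union> {u + l<..v + l})"
      by (rule measure_Un_le) auto
    also have "measure \<Lambda> ({u<..v} \<union> {u + l<..v + l}) \<le> measure \<Lambda> {u<..v} + measure \<Lambda> {u + l<..v + l}"
      by (rule measure_Un_le) auto
    finally show ?thesis using small by linarith
  qed
  then have le: "exp (- measure \<Lambda> {v<..u + l}) \<le> exp 1 * exp (- measure \<Lambda> {t<..t + l})"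
    if "u < t" "t \<le> v" for t
    unfolding exp_add[symmetric] using \<open>\<And>t. _ \<Longrightarrow> _ \<Longrightarrow> measure \<Lambda> {t<..t + l} \<le> _\<close>[OF that] by simp
  have "ennreal (measure \<Lambda> {u<..v} * exp (- measure \<Lambda> {v<..u + l})) =
      (\<integral>\<^sup>+t. ennreal (exp (- measure \<Lambda> {v<..u + l})) * indicator {u<..v} t \<partial>\<Lambda>)"
    by (simp add: nn_integral_const_bounded)
  also have "\<dots> \<le> (\<integral>\<^sup>+t. ennreal (exp 1) *
      (ennreal (exp (- measure \<Lambda> {t<..t + l})) * indicator {u<..v} t) \<partial>\<Lambda>)"
    by (intro nn_integral_mono)
       (auto split: split_indicator simp: ennreal_mult''[symmetric] intro!: ennreal_leI le)
  also have "\<dots> = ennreal (exp 1) * emeasure (gap_intensity l) {u<..v}"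
    using l by (subst nn_integral_cmult) (auto simp: emeasure_gap_intensity)
  finally show ?thesis .
qed

end

section \<open>Void probabilities and independence\<close>

text \<open>By Renyi's theorem the void probabilities determine a simple point process; independence over
  disjoint sets comes from their exponential form (see \<open>void_algebra_indep\<close>).\<close>
locale void_process = prob_space P + diffuse_intensity \<Lambda>
  for P :: "'w measure" and \<Lambda> :: "real measure" +
  fixes N :: "'w \<Rightarrow> real set"
  assumes locally_finite: "\<omega> \<in> space P \<Longrightarrow> finite (N \<omega> \<inter> {..t})"
    and void_event: "A \<in> sets borel \<Longrightarrow> bounded A \<Longrightarrow> {\<omega> \<in> space P. N \<omega> \<inter> A = {}} \<in> sets P"
    and void_prob: "A \<in> sets borel \<Longrightarrow> bounded A \<Longrightarrow>
      measure P {\<omega> \<in> space P. N \<omega> \<inter> A = {}} = exp (- measure \<Lambda> A)"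
begin

definition void :: "real set \<Rightarrow> 'w set" where "void A = {\<omega> \<in> space P. N \<omega> \<inter> A = {}}"
definition hit :: "real set \<Rightarrow> 'w set" where "hit A = {\<omega> \<in> space P. N \<omega> \<inter> A \<noteq> {}}"

definition voids :: "real set \<Rightarrow> 'w set set" where
  "voids U = void ` {A \<in> sets borel. bounded A \<and> A \<subseteq> U}"

definition void_algebra :: "real set \<Rightarrow> 'w measure" where "void_algebra U = sigma (space P) (voids U)"

lemma prob_void: "A \<in> sets borel \<Longrightarrow> bounded A \<Longrightarrow> prob (void A) = exp (- measure \<Lambda> A)"
  unfolding void_def by (rule void_prob)

lemma voids_subset: "voids U \<subseteq> events"
  unfolding voids_def void_def using void_event by auto

lemma sets_void_algebra: "sets (void_algebra U) = sigma_sets (space P) (voids U)"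
  unfolding void_algebra_def using subset_trans[OF voids_subset sets.space_closed] by (rule sets_measure_of)

lemma space_void_algebra [simp]: "space (void_algebra U) = space P"
  unfolding void_algebra_def using subset_trans[OF voids_subset sets.space_closed] by (rule space_measure_of)

lemma void_algebra_events: "E \<in> sets (void_algebra U) \<Longrightarrow> E \<in> events"
  unfolding sets_void_algebra using sets.sigma_sets_subset[OF voids_subset] by blast

lemma void_algebra_mono: "U \<subseteq> V \<Longrightarrow> E \<in> sets (void_algebra U) \<Longrightarrow> E \<in> sets (void_algebra V)"
  unfolding sets_void_algebra by (rule subsetD[OF sigma_sets_mono']) (auto simp: voids_def)

lemma void_void_algebra:
  "A \<in> sets borel \<Longrightarrow> bounded A \<Longrightarrow> A \<subseteq> U \<Longrightarrow> void A \<in> sets (void_algebra U)"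
  unfolding sets_void_algebra by (rule sigma_sets.Basic) (auto simp: voids_def)

lemma hit_eq: "hit A = space P - void A"
  by (auto simp: hit_def void_def)

lemma hit_void_algebra:
  assumes "A \<in> sets borel" "bounded A" "A \<subseteq> U" shows "hit A \<in> sets (void_algebra U)"
  using sets.compl_sets[OF void_void_algebra[OF assms]] by (simp add: hit_eq)

lemma prob_hit:
  assumes "A \<in> sets borel" "bounded A" shows "prob (hit A) = 1 - exp (- measure \<Lambda> A)"
  unfolding hit_eq using assms void_algebra_events[OF void_void_algebra[of A UNIV]]
  by (subst prob_compl) (auto simp: prob_void)

lemma void_Un: "void A \<inter> void B = void (A \<union> B)"
  by (auto simp: void_def)

text \<open>The void events inside \<open>U\<close> are closed under intersection, since \<open>A\<close> and \<open>B\<close> are both void iff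
  \<open>A \<union> B\<close> is, and \<open>exp (- \<Lambda> (A \<union> B))\<close> factorises for disjoint \<open>A\<close> and \<open>B\<close>.\<close>
lemma void_algebra_indep:
  assumes UV: "U \<inter> V = {}" and E: "E \<in> sets (void_algebra U)" "E' \<in> sets (void_algebra V)"
  shows "prob (E \<inter> E') = prob E * prob E'"
proof (rule indep_setD)
  have stable: "Int_stable (voids W)" for W
    unfolding Int_stable_def voids_def
    by (auto simp: void_Un intro!: imageI)
  have "indep_set (voids U) (voids V)"
  proof (rule indep_setI)
    fix a b assume "a \<in> voids U" "b \<in> voids V"
    then obtain A B where AB: "a = void A" "b = void B" "A \<in> sets borel" "B \<in> sets borel"
      "bounded A" "bounded B" "A \<inter> B = {}"
      using UV unfolding voids_def by blast
    then have "measure \<Lambda> (A \<union> B) = measure \<Lambda> A + measure \<Lambda> B"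
      using fmeasurableD2[OF fmeasurable_bounded] by (intro measure_Union) auto
    with AB show "prob (a \<inter> b) = prob a * prob b"
      by (simp add: void_Un prob_void exp_add[symmetric])
  qed (rule voids_subset)+
  then show "indep_set (sets (void_algebra U)) (sets (void_algebra V))"
    unfolding sets_void_algebra by (intro indep_set_sigma_sets stable)
qed (fact E)+

text \<open>For \<open>V = UNIV\<close> this is the event \<open>D = \<infinity>\<close>; smaller \<open>V\<close> describe the process after deletion of the
  points outside \<open>V\<close>.\<close>
definition covered :: "real \<Rightarrow> real set \<Rightarrow> 'w set" where
  "covered l V = {\<omega> \<in> space P. \<forall>s\<ge>0. N \<omega> \<inter> V \<inter> {s<..<s + l} \<noteq> {}}"

lemma covered_void_algebra:
  assumes l: "0 < l" and V: "V \<in> sets borel" shows "covered l V \<in> sets (void_algebra V)"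
proof -
  have "covered l V = space (void_algebra V) -
      (\<Union>m::nat. \<Inter>k::nat. \<Union>r\<in>\<rat> \<inter> {0..real m}. void (V \<inter> {r<..<r + l - 1 / real (Suc k)}))"
    (is "_ = _ - ?E")
  proof (intro set_eqI)
    fix \<omega>
    show "\<omega> \<in> covered l V \<longleftrightarrow> \<omega> \<in> space (void_algebra V) - ?E"
    proof -
      have "\<omega> \<in> covered l V \<longleftrightarrow> \<omega> \<in> space P \<and> \<not> (\<exists>s\<ge>0. N \<omega> \<inter> V \<inter> {s<..<s + l} = {})"
        by (auto simp: covered_def)
      also have "\<dots> \<longleftrightarrow> \<omega> \<in> space P \<and> \<not> (\<exists>m::nat. \<forall>k::nat. \<exists>r\<in>\<rat> \<inter> {0..real m}.
          N \<omega> \<inter> V \<inter> {r<..<r + l - 1 / real (Suc k)} = {})"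
        unfolding empty_window_iff[OF l] ..
      also have "\<dots> \<longleftrightarrow> \<omega> \<in> space (void_algebra V) - ?E"
        unfolding void_def space_void_algebra Int_assoc by blast
      finally show ?thesis .
    qed
  qed
  also have "\<dots> \<in> sets (void_algebra V)"
    using V by (intro sets.compl_sets sets.countable_UN sets.countable_INT image_subsetI
        sets.countable_UN' void_void_algebra countable_Int1 countable_rat) auto
  finally show ?thesis .
qed

text \<open>A special case of Harris' inequality: being covered and hitting \<open>J\<close> are both increasing in the point
  set.  If \<open>J\<close> is void, being covered is decided by the points outside \<open>J\<close>, hence independent of
  \<open>J\<close> being void; and a process covered after deletion of \<open>J\<close> is covered before it.\<close>
lemma covered_hit_correlation:
  assumes l: "0 < l" and J: "J \<in> sets borel" "bounded J"
  shows "prob (covered l UNIV) * prob (hit J) \<le> prob (covered l UNIV \<inter> hit J)"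
proof -
  have cov: "covered l V \<in> events" if "V \<in> sets borel" for V
    using void_algebra_events[OF covered_void_algebra[OF l that]] .
  have void: "void J \<in> events" using void_algebra_events[OF void_void_algebra[of J UNIV]] J by simp
  have "covered l UNIV \<inter> void J = covered l (- J) \<inter> void J"
    by (auto simp: covered_def void_def)
  then have "prob (covered l UNIV \<inter> void J) = prob (covered l (- J)) * prob (void J)"
    using void_algebra_indep[of "- J" J] covered_void_algebra[OF l, of "- J"] void_void_algebra[of J J] J by simp
  also have "\<dots> \<le> prob (covered l UNIV) * prob (void J)"
    using cov[of UNIV] by (intro mult_right_mono finite_measure_mono) (simp, auto simp: covered_def)
  finally have "prob (covered l UNIV \<inter> void J) \<le> prob (covered l UNIV) * prob (void J)" .
  moreover have "prob (covered l UNIV \<inter> hit J) = prob (covered l UNIV) - prob (covered l UNIV \<inter> void J)"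
  proof -
    have "covered l UNIV \<inter> hit J = covered l UNIV - covered l UNIV \<inter> void J"
      by (auto simp: hit_eq covered_def)
    then show ?thesis using cov[of UNIV] void by (simp add: finite_measure_Diff)
  qed
  moreover have "prob (hit J) = 1 - prob (void J)" unfolding hit_eq using void by (rule prob_compl)
  ultimately show ?thesis by (simp add: right_diff_distrib)
qed

end

section \<open>Almost sure termination\<close>

lemma one_minus_exp_ge_half:
  fixes x :: real assumes "0 \<le> x" "x \<le> 1" shows "x / 2 \<le> 1 - exp (- x)"
proof -
  have "exp (- x) \<le> 1 / (1 + x)"
    using exp_ge_add_one_self[of x] assms by (simp add: exp_minus field_simps)
  also have "\<dots> \<le> 1 - x / 2"
    using assms mult_left_mono[of x 1 x] by (simp add: field_simps)
  finally show ?thesis by simp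
qed

context void_process
begin

lemma covered_events:
  assumes "0 < l" "V \<in> sets borel" shows "covered l V \<in> events"
  using void_algebra_events[OF covered_void_algebra[OF assms]] .

lemma void_events: "A \<in> sets borel \<Longrightarrow> bounded A \<Longrightarrow> void A \<in> events"
  by (rule void_algebra_events[OF void_void_algebra[of A UNIV]]) auto

lemma hit_events: "A \<in> sets borel \<Longrightarrow> bounded A \<Longrightarrow> hit A \<in> events"
  by (rule void_algebra_events[OF hit_void_algebra[of A UNIV]]) auto

text \<open>With finite total intensity the window \<open>(t, t + l)\<close> is void with probability close to \<open>1\<close> for large
  \<open>t\<close>, while a covered process hits it.\<close>
lemma covered_null_finite:
  assumes l: "0 < l" and fin: "emeasure \<Lambda> {0<..} < \<infinity>"
  shows "prob (covered l UNIV) = 0"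
proof (rule ccontr)
  assume "prob (covered l UNIV) \<noteq> 0"
  then have pos: "0 < prob (covered l UNIV)" by (simp add: zero_less_measure_iff)
  obtain t where t: "0 < t" "emeasure \<Lambda> {t<..} < ennreal (prob (covered l UNIV))"
    using tail_emeasure_small[OF sets_intensity fin, of "ennreal (prob (covered l UNIV))"] pos by auto
  let ?W = "{t<..<t + l}"
  have "emeasure \<Lambda> ?W \<le> emeasure \<Lambda> {t<..}" by (intro emeasure_mono) auto
  then have "ennreal (measure \<Lambda> ?W) < ennreal (prob (covered l UNIV))"
    using t by (simp add: emeasure_bounded[symmetric])
  then have less: "measure \<Lambda> ?W < prob (covered l UNIV)" by (simp add: ennreal_less_iff)
  have "covered l UNIV \<subseteq> hit ?W" using t by (auto simp: covered_def hit_def)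
  then have "prob (covered l UNIV) \<le> prob (hit ?W)"
    by (intro finite_measure_mono hit_events) auto
  also have "\<dots> = 1 - exp (- measure \<Lambda> ?W)" by (rule prob_hit) auto
  also have "\<dots> \<le> measure \<Lambda> ?W" using exp_ge_add_one_self[of "- measure \<Lambda> ?W"] by simp
  finally show False using less by simp
qed

text \<open>With probability at most \<open>1\<close> there is a first cell \<open>J\<^sub>i\<close> that is hit and followed by the void window
  \<open>W\<^sub>i\<close>.  Up to the points of \<open>J\<^sub>i\<close>, being first is implied by being covered, so by the correlation
  inequality cell \<open>i\<close> is first with probability at least \<open>P(D = \<infinity>) P(J\<^sub>i hit) P(W\<^sub>i void)\<close>, a fixed multiple of
  \<open>P(D = \<infinity>)\<close> times the share of \<open>J\<^sub>i\<close> in \<open>I\<close>.  Summing over \<open>i\<close> gives \<open>P(D = \<infinity>) I \<le> 2 e\<close>, which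
  forces \<open>P(D = \<infinity>) = 0\<close> when \<open>I = \<infinity>\<close>.\<close>
lemma covered_null_infinite:
  assumes l: "0 < l" and inf: "emeasure \<Lambda> {0<..} = \<infinity>"
    and gaps: "emeasure (gap_intensity l) {0<..} = \<infinity>"
  shows "prob (covered l UNIV) = 0"
proof -
  let ?q = "prob (covered l UNIV)"
  obtain c where c: "cells l 0 c" by (rule cells_exist[OF inf l])
  have c_mono: "c i \<le> c j" if "i \<le> j" for i j
    using c that by (auto simp: cells_def strict_mono_less_eq)
  have c_nonneg: "0 \<le> c i" for i using c_mono[of 0 i] c by (simp add: cells_def)
  define J where "J i = {c i<..c (Suc i)}" for i
  define W where "W i = {c (Suc i)<..c (Suc i) + l}" for i
  have J: "J i \<in> sets borel" "bounded (J i)" and W: "W i \<in> sets borel" "bounded (W i)" for i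
    by (auto simp: J_def W_def)
  \<comment> \<open>\<open>L i\<close> keeps only those earlier cells whose windows end before cell \<open>i\<close> does, so that it depends on
     the points up to \<open>c (Suc i)\<close> alone.  Nothing is lost: an earlier window that ends later
     contains \<open>J i\<close> and is not void when \<open>J i\<close> is hit.\<close>
  define L where "L i = hit (J i) -
    (\<Union>j\<in>{j. j < i \<and> c (Suc j) + l \<le> c (Suc i)}. hit (J j) \<inter> void (W j))" for i
  define G where "G i = L i \<inter> void (W i)" for i
  have L_void_algebra: "L i \<in> sets (void_algebra {..c (Suc i)})" for i
    unfolding L_def
    by (intro sets.Diff sets.finite_UN sets.Int hit_void_algebra void_void_algebra J W)
       (use c_mono l in \<open>auto simp: J_def W_def intro: order.trans\<close>)
  have G_events: "G i \<in> events" for i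
    unfolding G_def using void_algebra_events[OF L_void_algebra] void_events[OF W] by blast
  have "disjoint_family G"
  proof -
    have "G j \<inter> G i = {}" if "j < i" for i j
    proof (cases "c (Suc j) + l \<le> c (Suc i)")
      case True
      then have "L i \<inter> (hit (J j) \<inter> void (W j)) = {}" using that by (auto simp: L_def)
      then show ?thesis by (auto simp: G_def L_def[of j])
    next
      case False
      then have "J i \<subseteq> W j" using c_mono[of "Suc j" i] that by (auto simp: J_def W_def)
      then have "hit (J i) \<inter> void (W j) = {}" by (auto simp: hit_def void_def)
      then show ?thesis by (auto simp: G_def L_def)
    qed
    then show ?thesis unfolding disjoint_family_on_def by (metis Int_commute nat_neq_iff)
  qed
  then have "(\<Sum>i. emeasure P (G i)) = emeasure P (\<Union>i. G i)"
    using G_events by (intro suminf_emeasure) auto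
  then have sum_G: "(\<Sum>i. emeasure P (G i)) \<le> 1" by (simp add: emeasure_le_1)
  have J_in_cells: "(\<Sum>i. emeasure (gap_intensity l) (J i)) = \<infinity>"
    using suminf_emeasure[of "\<lambda>i. {c i<..c (Suc i)}" "gap_intensity l"] cells_disjoint[OF c] gaps
    unfolding J_def by (simp add: cells_UN[OF c] image_subset_iff)
  have "ennreal (?q / (2 * exp 1)) * emeasure (gap_intensity l) (J i) \<le> emeasure P (G i)" for i
  proof -
    let ?x = "measure \<Lambda> (J i)" and ?w = "measure \<Lambda> {c (Suc i)<..c i + l}"
    have small: "?x + measure \<Lambda> {c i + l<..c (Suc i) + l} \<le> 1"
      using c by (auto simp: cells_def J_def)
    have x1: "?x \<le> 1" using small measure_nonneg[of \<Lambda> "{c i + l<..c (Suc i) + l}"] by linarith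
    have "measure \<Lambda> (W i) \<le> measure \<Lambda> ({c (Suc i)<..c i + l} \<union> {c i + l<..c (Suc i) + l})"
      using c_mono[of i "Suc i"] unfolding W_def by (intro measure_mono_bounded) auto
    also have "\<dots> \<le> ?w + measure \<Lambda> {c i + l<..c (Suc i) + l}" by (rule measure_Un_le) auto
    finally have w: "measure \<Lambda> (W i) \<le> ?w + 1" using small measure_nonneg[of \<Lambda> "J i"] by linarith
    have "covered l UNIV \<inter> void (W j) = {}" for j
    proof -
      have "{c (Suc j)<..<c (Suc j) + l} \<subseteq> W j" by (auto simp: W_def)
      then show ?thesis using c_nonneg[of "Suc j"] by (fastforce simp: covered_def void_def)
    qed
    then have sub: "covered l UNIV \<inter> hit (J i) \<subseteq> L i" by (auto simp: L_def)
    have "?q * (?x / 2) \<le> ?q * prob (hit (J i))"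
      using one_minus_exp_ge_half[of ?x] x1 J by (intro mult_left_mono) (simp_all add: prob_hit)
    also have "\<dots> \<le> prob (covered l UNIV \<inter> hit (J i))"
      by (rule covered_hit_correlation[OF l J])
    also have "\<dots> \<le> prob (L i)"
      using sub void_algebra_events[OF L_void_algebra] by (rule finite_measure_mono)
    finally have L: "?q * (?x / 2) \<le> prob (L i)" .
    have "?q / (2 * exp 1) * (?x * exp (- ?w)) = ?q * (?x / 2) * exp (- (?w + 1))"
      by (simp add: exp_diff exp_minus field_simps)
    also have "\<dots> \<le> prob (L i) * prob (void (W i))"
      using L w W by (intro mult_mono) (simp_all add: prob_void)
    also have "\<dots> = prob (G i)"
      unfolding G_def using W
      by (intro void_algebra_indep[of "{..c (Suc i)}" "W i", symmetric] L_void_algebra void_void_algebra)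
         (auto simp: W_def)
    finally have "?q / (2 * exp 1) * (?x * exp (- ?w)) \<le> prob (G i)" .
    then have "ennreal (?q / (2 * exp 1)) * ennreal (?x * exp (- ?w)) \<le> emeasure P (G i)"
      by (simp add: emeasure_eq_measure ennreal_mult[symmetric])
    moreover have "emeasure (gap_intensity l) (J i) \<le> ennreal (?x * exp (- ?w))"
      unfolding J_def by (rule gap_intensity_le[OF l])
    ultimately show ?thesis by (meson mult_left_mono order.trans zero_le)
  qed
  then have "(\<Sum>i. ennreal (?q / (2 * exp 1)) * emeasure (gap_intensity l) (J i)) \<le> 1"
    by (intro order.trans[OF suminf_le[OF _ summableI summableI] sum_G])
  then have "ennreal (?q / (2 * exp 1)) * \<infinity> \<le> 1" using J_in_cells by simp
  then have "\<not> 0 < ?q"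
    by (auto simp: ennreal_mult_top top_unique)
  then show ?thesis by (simp add: zero_less_measure_iff)
qed

text \<open>Finitely many consecutive cells of length \<open>h\<close> are all hit with positive probability; this is where the
  positivity of the intensity on intervals enters.\<close>
lemma prob_hits_positive:
  assumes pos: "\<And>a b. 0 \<le> a \<Longrightarrow> a < b \<Longrightarrow> 0 < measure \<Lambda> {a<..b}" and h: "0 < h"
  defines "B \<equiv> \<lambda>n. space P \<inter> (\<Inter>k\<in>{..<n}. hit {real k * h<..real (Suc k) * h})"
  shows "B n \<in> sets (void_algebra {..real n * h})" "0 < prob (B n)"
proof -
  show B: "B n \<in> sets (void_algebra {..real n * h})" for n
  proof (induction n)
    case 0
    then show ?case using sets.top[of "void_algebra {..0}"] by (simp add: B_def)
  next
    case (Suc n)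
    have "B (Suc n) = B n \<inter> hit {real n * h<..real (Suc n) * h}"
      by (auto simp: B_def lessThan_Suc)
    moreover have "B n \<in> sets (void_algebra {..real (Suc n) * h})"
      using h by (intro void_algebra_mono[OF _ Suc]) (auto simp: algebra_simps)
    ultimately show ?case by (auto intro!: hit_void_algebra)
  qed
  show "0 < prob (B n)"
  proof (induction n)
    case 0
    then show ?case by (simp add: B_def prob_space)
  next
    case (Suc n)
    let ?J = "{real n * h<..real (Suc n) * h}"
    have "B (Suc n) = B n \<inter> hit ?J" by (auto simp: B_def lessThan_Suc)
    then have "prob (B (Suc n)) = prob (B n) * prob (hit ?J)"
      using B[of n] by (simp only:) (intro void_algebra_indep[of "{..real n * h}" ?J] hit_void_algebra, auto)
    moreover have "0 < prob (hit ?J)" using pos[of "real n * h" "real (Suc n) * h"] h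
      by (simp add: prob_hit)
    ultimately show ?case using Suc by simp
  qed
qed

end

section \<open>Positive probability of no termination\<close>

context diffuse_intensity
begin

text \<open>Otherwise \<open>\<Lambda>(s, s + l] \<le> 1\<close> for all large \<open>s\<close>, so the gap integrand is at least \<open>e\<^sup>-\<^sup>1\<close> times the rate
  and the infinite total intensity makes the gap integral infinite.\<close>
lemma dense_half_window:
  assumes l: "0 < l" and inf: "emeasure \<Lambda> {0<..} = \<infinity>"
    and gaps: "emeasure (gap_intensity l) {0<..} < \<infinity>" and t: "0 \<le> t"
  shows "\<exists>a\<ge>t. 1 / 2 \<le> measure \<Lambda> {a<..a + l / 2}"
proof (rule ccontr)
  assume "\<not> ?thesis"
  then have sparse: "measure \<Lambda> {s<..s + l / 2} < 1 / 2" if "t \<le> s" for s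
    using that by (meson not_less)
  have window: "measure \<Lambda> {s<..s + l} \<le> 1" if "t \<le> s" for s
  proof -
    have "measure \<Lambda> {s<..s + l} \<le> measure \<Lambda> ({s<..s + l / 2} \<union> {s + l / 2<..s + l / 2 + l / 2})"
      using l by (intro measure_mono_bounded) auto
    also have "\<dots> \<le> measure \<Lambda> {s<..s + l / 2} + measure \<Lambda> {s + l / 2<..s + l / 2 + l / 2}"
      by (rule measure_Un_le) auto
    also have "\<dots> \<le> 1" using sparse[of s] sparse[of "s + l / 2"] that l by simp
    finally show ?thesis .
  qed
  have "ennreal (exp (- 1)) * emeasure \<Lambda> {t<..} = (\<integral>\<^sup>+s. ennreal (exp (- 1)) * indicator {t<..} s \<partial>\<Lambda>)"
    by (rule nn_integral_cmult_indicator[symmetric]) simp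
  also have "\<dots> \<le> emeasure (gap_intensity l) {t<..}"
    unfolding emeasure_gap_intensity[OF l, of "{t<..}", simplified]
    by (intro nn_integral_mono) (auto split: split_indicator intro!: ennreal_leI window)
  also have "\<dots> \<le> emeasure (gap_intensity l) {0<..}" using t by (intro emeasure_mono) auto
  finally have "emeasure \<Lambda> {t<..} < \<infinity>"
    using gaps
    by (cases "emeasure \<Lambda> {t<..} = \<infinity>") (auto simp: ennreal_mult_top top_unique less_top[symmetric])
  then have "emeasure \<Lambda> {0<..t} + emeasure \<Lambda> {t<..} < \<infinity>"
    by (simp add: emeasure_bounded)
  also have "emeasure \<Lambda> {0<..t} + emeasure \<Lambda> {t<..} = emeasure \<Lambda> ({0<..t} \<union> {t<..})"
    by (rule plus_emeasure) auto
  also have "{0<..t} \<union> {t<..} = {0<..}" using t by auto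
  finally show False using inf by simp
qed

end

context void_process
begin
text \<open>An empty window at \<open>s\<close> leaves, after the last point \<open>p \<le> s\<close>, no point before \<open>s + l\<close>; if \<open>p\<close> is in the
  \<open>i\<close>-th cell, this includes all of \<open>(c\<^sub>i\<^sub>+\<^sub>1, c\<^sub>i + l]\<close>.  The points in \<open>(a, a + l/2]\<close> guarantee that there is
  such a \<open>p\<close> above \<open>a\<close>, for otherwise one of them lies in the window.\<close>
lemma window_hit_of_no_gap_in_cells:
  assumes \<omega>: "\<omega> \<in> space P" and l: "0 < l" and c: "cells l a c" and start: "N \<omega> \<inter> {a<..a + l / 2} \<noteq> {}"
    and no_gap: "\<And>i. \<omega> \<notin> hit {c i<..c (Suc i)} \<inter> void {c (Suc i)<..c i + l}"
    and s: "a \<le> s"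
  shows "N \<omega> \<inter> {s<..<s + l} \<noteq> {}"
proof
  assume empty: "N \<omega> \<inter> {s<..<s + l} = {}"
  let ?F = "N \<omega> \<inter> {a<..s}"
  have fin: "finite ?F" using locally_finite[OF \<omega>, of s] by (rule finite_subset[rotated]) auto
  have "?F \<noteq> {}"
  proof
    assume "?F = {}"
    with start obtain x where "x \<in> N \<omega>" "s < x" "x \<le> a + l / 2" by force
    then show False using empty s l by force
  qed
  then have p: "Max ?F \<in> ?F" using fin by (rule Max_in[rotated])
  define p where "p = Max ?F"
  have p: "p \<in> N \<omega>" "a < p" "p \<le> s" using p by (auto simp: p_def)
  obtain i where i: "c i < p" "p \<le> c (Suc i)" by (rule cells_cover[OF c p(2)])
  have "x \<notin> N \<omega>" if x: "c (Suc i) < x" "x \<le> c i + l" for x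
  proof
    assume xN: "x \<in> N \<omega>"
    show False
    proof (cases "x \<le> s")
      case True
      then have "x \<le> p" unfolding p_def using fin x p i xN by (intro Max_ge) auto
      then show False using x i by simp
    next
      case False
      then show False using empty xN x i p by force
    qed
  qed
  then have "\<omega> \<in> hit {c i<..c (Suc i)} \<inter> void {c (Suc i)<..c i + l}"
    using \<omega> p i by (auto simp: hit_def void_def)
  with no_gap show False by blast
qed

text \<open>Three events together cover the process: the cells of a fine mesh of \<open>(0, a]\<close> are all hit (\<open>B\<close>), the
  interval \<open>(a, a + l/2]\<close> is hit (\<open>C\<close>), and no gap starts beyond \<open>a\<close> (none of the \<open>E i\<close>).  The first is
  independent of the other two and has positive probability.  The last fails with probability at most
  \<open>e\<close> times the tail of the gap integral beyond \<open>a\<close>.  For \<open>C\<close> to be more likely than this failure, \<open>a\<close> is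
  taken so far out that the failure probability is below \<open>\<epsilon> = 1 - e\<^sup>-\<^sup>1\<^sup>/\<^sup>2\<close>, and with mass at least
  \<open>1/2\<close> in \<open>(a, a + l/2]\<close>.\<close>
lemma covered_positive:
  assumes l: "0 < l" and inf: "emeasure \<Lambda> {0<..} = \<infinity>"
    and gaps: "emeasure (gap_intensity l) {0<..} < \<infinity>"
    and pos: "\<And>a b. 0 \<le> a \<Longrightarrow> a < b \<Longrightarrow> 0 < measure \<Lambda> {a<..b}"
  shows "0 < prob (covered l UNIV)"
proof -
  define \<epsilon> :: real where "\<epsilon> = 1 - exp (- 1 / 2)"
  have \<epsilon>: "0 < \<epsilon>" by (simp add: \<epsilon>_def)
  obtain t where t: "0 < t" "emeasure (gap_intensity l) {t<..} < ennreal (\<epsilon> / exp 1)"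
    using tail_emeasure_small[OF sets_gap_intensity gaps, of "ennreal (\<epsilon> / exp 1)"] \<epsilon> by auto
  obtain a where a: "t \<le> a" "1 / 2 \<le> measure \<Lambda> {a<..a + l / 2}"
    using dense_half_window[OF l inf gaps, of t] t by auto
  obtain c where c: "cells l a c" by (rule cells_exist[OF inf l])
  have c_ge: "a \<le> c i" for i using c strict_mono_less_eq[of c 0 i] by (auto simp: cells_def)
  define E where "E i = hit {c i<..c (Suc i)} \<inter> void {c (Suc i)<..c i + l}" for i
  have E_void_algebra: "E i \<in> sets (void_algebra {a<..})" for i
    unfolding E_def using c_ge[of i] c_ge[of "Suc i"]
    by (intro sets.Int hit_void_algebra void_void_algebra) auto
  have E_le: "emeasure P (E i) \<le> ennreal (exp 1) * emeasure (gap_intensity l) {c i<..c (Suc i)}" for i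
  proof -
    let ?x = "measure \<Lambda> {c i<..c (Suc i)}" and ?w = "measure \<Lambda> {c (Suc i)<..c i + l}"
    have "prob (E i) = prob (hit {c i<..c (Suc i)}) * prob (void {c (Suc i)<..c i + l})"
      unfolding E_def
      by (rule void_algebra_indep[of "{c i<..c (Suc i)}" "{c (Suc i)<..c i + l}"])
         (auto intro!: hit_void_algebra void_void_algebra)
    also have "\<dots> \<le> ?x * exp (- ?w)"
      using exp_ge_add_one_self[of "- ?x"] by (intro mult_mono) (simp_all add: prob_hit prob_void)
    finally have "emeasure P (E i) \<le> ennreal (?x * exp (- ?w))"
      by (simp add: emeasure_eq_measure ennreal_leI)
    also have "\<dots> \<le> ennreal (exp 1) * emeasure (gap_intensity l) {c i<..c (Suc i)}"
      using c by (intro gap_intensity_ge l) (simp add: cells_def)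
    finally show ?thesis .
  qed
  have "emeasure P (\<Union>i. E i) \<le> (\<Sum>i. emeasure P (E i))"
    using void_algebra_events[OF E_void_algebra] by (intro emeasure_subadditive_countably) auto
  also have "\<dots> \<le> (\<Sum>i. ennreal (exp 1) * emeasure (gap_intensity l) {c i<..c (Suc i)})"
    by (intro suminf_le E_le) auto
  also have "\<dots> = ennreal (exp 1) * emeasure (gap_intensity l) {a<..}"
    using suminf_emeasure[of "\<lambda>i. {c i<..c (Suc i)}" "gap_intensity l"] cells_disjoint[OF c]
    by (simp add: cells_UN[OF c] image_subset_iff)
  also have "\<dots> \<le> ennreal (exp 1) * emeasure (gap_intensity l) {t<..}"
    using a by (intro mult_left_mono emeasure_mono) auto
  also have "\<dots> < ennreal (exp 1) * ennreal (\<epsilon> / exp 1)"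
    using t(2) by (intro ennreal_mult_strict_left_mono) auto
  also have "\<dots> = ennreal \<epsilon>" using \<epsilon> by (simp add: ennreal_mult[symmetric])
  finally have E_less: "prob (\<Union>i. E i) < \<epsilon>"
    by (simp add: emeasure_eq_measure ennreal_less_iff)
  define C where "C = hit {a<..a + l / 2}"
  have C: "\<epsilon> \<le> prob C" using a by (simp add: C_def prob_hit \<epsilon>_def)
  have UE: "(\<Union>i. E i) \<in> events" using void_algebra_events[OF E_void_algebra] by auto
  have CE_void_algebra: "C - (\<Union>i. E i) \<in> sets (void_algebra {a<..})"
    using E_void_algebra unfolding C_def by (intro sets.Diff sets.countable_UN hit_void_algebra) auto
  have "prob C - prob (\<Union>i. E i) \<le> prob (C - (\<Union>i. E i))"
  proof -
    have "prob C \<le> prob ((C - (\<Union>i. E i)) \<union> (\<Union>i. E i))"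
      by (intro finite_measure_mono sets.Un void_algebra_events[OF CE_void_algebra] UE) auto
    also have "\<dots> \<le> prob (C - (\<Union>i. E i)) + prob (\<Union>i. E i)"
      by (intro measure_Un_le void_algebra_events[OF CE_void_algebra] UE)
    finally show ?thesis by simp
  qed
  then have CE: "0 < prob (C - (\<Union>i. E i))" using C E_less by linarith
  \<comment> \<open>The mesh \<open>h\<close> is below \<open>l / 2\<close>: a window of length \<open>l\<close> opened inside a cell then contains the next one.\<close>
  obtain n :: nat where n: "2 * a / l < real n" using reals_Archimedean2 by blast
  then have n0: "0 < n" using a t l by (cases n) (auto simp: field_simps)
  define h where "h = a / real n"
  have h: "0 < h" "real n * h = a" "2 * h < l" using a t n n0 l by (auto simp: h_def field_simps)
  define B where "B = space P \<inter> (\<Inter>k\<in>{..<n}. hit {real k * h<..real (Suc k) * h})"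
  have B: "B \<in> sets (void_algebra {..a})" "0 < prob B"
    using prob_hits_positive[OF pos h(1), of n] unfolding B_def h(2) by auto
  have "\<omega> \<in> covered l UNIV" if \<omega>: "\<omega> \<in> B \<inter> (C - (\<Union>i. E i))" for \<omega>
  proof -
    have sp: "\<omega> \<in> space P" and start: "N \<omega> \<inter> {a<..a + l / 2} \<noteq> {}"
      using \<omega> by (auto simp: B_def C_def hit_def)
    have "N \<omega> \<inter> {s<..<s + l} \<noteq> {}" if s: "0 \<le> s" for s
    proof (cases "a \<le> s")
      case True
      show ?thesis
        using \<omega> by (intro window_hit_of_no_gap_in_cells[OF sp l c start _ True]) (auto simp: E_def)
    next
      case False
      define k where "k = nat \<lfloor>s / h\<rfloor>"
      have "real k = of_int \<lfloor>s / h\<rfloor>" using s h by (simp add: k_def)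
      then have "real k \<le> s / h" "s / h < real k + 1" by linarith+
      then have k: "real k * h \<le> s" "s < real (Suc k) * h" using h by (simp_all add: field_simps)
      have "real k * h < real n * h" using k False h by linarith
      then have "k < n" using h by (metis mult_less_cancel_right_pos of_nat_less_iff)
      show ?thesis
      proof (cases "Suc k < n")
        case True
        then have "\<omega> \<in> hit {real (Suc k) * h<..real (Suc (Suc k)) * h}"
          using \<omega> unfolding B_def by blast
        then obtain x where x: "x \<in> N \<omega>" "real (Suc k) * h < x" "x \<le> real (Suc (Suc k)) * h"
          by (auto simp: hit_def)
        have "real (Suc (Suc k)) * h = real k * h + 2 * h" by (simp add: algebra_simps)
        then have "x < s + l" using x k h by linarith
        then show ?thesis using x k by (intro ex_in_conv[THEN iffD1] exI[of _ x]) auto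
      next
        case last: False
        then have "Suc k = n" using \<open>k < n\<close> by simp
        then have "real k * h = a - h" using h(2) by (auto simp: algebra_simps)
        moreover obtain x where "x \<in> N \<omega>" "a < x" "x \<le> a + l / 2" using start by auto
        ultimately show ?thesis using False k h
          by (intro ex_in_conv[THEN iffD1] exI[of _ x]) auto
      qed
    qed
    then show ?thesis using sp by (simp add: covered_def)
  qed
  then have "B \<inter> (C - (\<Union>i. E i)) \<subseteq> covered l UNIV" by blast
  then have "prob (B \<inter> (C - (\<Union>i. E i))) \<le> prob (covered l UNIV)"
    using covered_events[OF l, of UNIV] by (intro finite_measure_mono) auto
  moreover have "prob (B \<inter> (C - (\<Union>i. E i))) = prob B * prob (C - (\<Union>i. E i))"
    by (rule void_algebra_indep[OF _ B(1) CE_void_algebra]) auto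
  ultimately show ?thesis using B(2) CE by (metis mult_pos_pos order.strict_trans2)
qed

end

section \<open>The Poisson process\<close>

lemma (in diffuse_intensity) measure_Ioo_eq_Ioc:
  assumes "a < b" shows "measure \<Lambda> {a<..<b} = measure \<Lambda> {a<..b}"
proof -
  have "{b} \<in> null_sets \<Lambda>" using diffuse[of b] by (auto intro: null_setsI)
  moreover have "{a<..<b} \<union> {b} = {a<..b}" using assms by auto
  ultimately show ?thesis using measure_Un_null_set[of "{a<..<b}" \<Lambda> "{b}"] by simp
qed

lemma (in void_process) first_gap_infinity_event:
  assumes "0 < l" shows "{\<omega> \<in> space P. first_gap l (N \<omega>) = \<infinity>} = covered l UNIV"
  using assms locally_finite by (auto simp: covered_def first_gap_eq_infinity_iff)

text \<open>The intensity measure as a measure on the whole line, without mass on \<open>(-\<infinity>, 0]\<close>.\<close>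
definition rate_measure :: "(real \<Rightarrow> real) \<Rightarrow> real measure" where
  "rate_measure \<mu> = density lborel (\<lambda>t. ennreal (\<mu> t) * indicator {0<..} t)"

context
  fixes \<mu> :: "real \<Rightarrow> real"
  assumes meas: "\<mu> \<in> borel_measurable (restrict_space lborel {0<..})"
begin

lemma rate_measurable [measurable]: "(\<lambda>t. ennreal (\<mu> t) * indicator {0<..} t) \<in> borel_measurable lborel"
proof -
  have "(\<lambda>t. ennreal (\<mu> t)) \<in> borel_measurable (restrict_space lborel {0<..})"
    using meas by simp
  then show ?thesis by (subst (asm) borel_measurable_restrict_space_iff_ennreal) auto
qed

lemma emeasure_rate_measure:
  assumes "A \<in> sets borel"
  shows "emeasure (rate_measure \<mu>) A = (\<integral>\<^sup>+t. ennreal (\<mu> t) * indicator (A \<inter> {0<..}) t \<partial>lborel)"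
  unfolding rate_measure_def using assms
  by (subst emeasure_density) (auto intro!: nn_integral_cong split: split_indicator)

lemma cumulative_rate_eq:
  assumes "0 \<le> a" shows "cumulative_rate \<mu> (ereal a) b = emeasure (rate_measure \<mu>) (einterval a b)"
proof -
  have "einterval (ereal a) b \<inter> {0<..} = einterval (ereal a) b"
    using assms by (auto simp: einterval_def)
  then show ?thesis by (simp add: emeasure_rate_measure cumulative_rate_def)
qed

lemma emeasure_intensity_measure:
  assumes "A \<in> sets borel"
  shows "A \<inter> {0<..} \<in> sets (intensity_measure \<mu>)"
    "emeasure (intensity_measure \<mu>) (A \<inter> {0<..}) = emeasure (rate_measure \<mu>) A"
proof -
  show sets: "A \<inter> {0<..} \<in> sets (intensity_measure \<mu>)"
    using assms by (auto simp: intensity_measure_def sets_restrict_space)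
  then have "emeasure (intensity_measure \<mu>) (A \<inter> {0<..}) =
      (\<integral>\<^sup>+t. ennreal (\<mu> t) * indicator (A \<inter> {0<..}) t \<partial>restrict_space lborel {0<..})"
    unfolding intensity_measure_def using meas by (intro emeasure_density) auto
  also have "\<dots> = (\<integral>\<^sup>+t. ennreal (\<mu> t) * indicator (A \<inter> {0<..}) t * indicator {0<..} t \<partial>lborel)"
    by (rule nn_integral_restrict_space) simp
  also have "\<dots> = emeasure (rate_measure \<mu>) A"
    unfolding emeasure_rate_measure[OF assms]
    by (intro nn_integral_cong) (auto split: split_indicator)
  finally show "emeasure (intensity_measure \<mu>) (A \<inter> {0<..}) = emeasure (rate_measure \<mu>) A" .
qed

lemma rate_measure_pos:
  assumes pos: "AE t in lborel. t \<ge> 0 \<longrightarrow> \<mu> t > 0" and ab: "0 \<le> a" "a < b"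
  shows "0 < emeasure (rate_measure \<mu>) {a<..b}"
proof (rule ccontr)
  assume "\<not> ?thesis"
  then have "(\<integral>\<^sup>+t. (ennreal (\<mu> t) * indicator {0<..} t) * indicator {a<..b} t \<partial>lborel) = 0"
    by (simp add: rate_measure_def emeasure_density)
  then have "AE t in lborel. (ennreal (\<mu> t) * indicator {0<..} t) * indicator {a<..b} t = 0"
    by (subst (asm) nn_integral_0_iff_AE) auto
  with pos have "AE t in lborel. t \<notin> {a<..b}"
    by eventually_elim (use ab in \<open>auto split: split_indicator_asm\<close>)
  then have "emeasure lborel {a<..b} = 0"
    by (subst (asm) AE_iff_measurable[of "{a<..b}"]) auto
  with ab show False by simp
qed

lemma diffuse_intensity_rate_measure:
  assumes fin: "\<And>t::real. cumulative_rate \<mu> 0 (ereal t) < \<infinity>"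
  shows "diffuse_intensity (rate_measure \<mu>)"
proof
  show sets: "sets (rate_measure \<mu>) = sets borel" by (simp add: rate_measure_def)
  show "emeasure (rate_measure \<mu>) {..t} < \<infinity>" for t
  proof -
    have "emeasure (rate_measure \<mu>) {..t} \<le> emeasure (rate_measure \<mu>) (einterval (ereal 0) (t + 1))"
      by (simp only: emeasure_rate_measure[OF borel_closed[OF closed_atMost]]
          emeasure_rate_measure[OF borel_einterval])
         (auto intro!: nn_integral_mono simp: einterval_def split: split_indicator)
    also have "\<dots> < \<infinity>"
      using fin[of "t + 1"] cumulative_rate_eq[of 0 "ereal (t + 1)"] by (simp add: zero_ereal_def)
    finally show ?thesis .
  qed
  show "emeasure (rate_measure \<mu>) {t} = 0" for t
    unfolding rate_measure_def
    by (subst emeasure_density) (auto intro!: nn_integral_null_set null_setsI)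
qed

lemma gap_integral_eq:
  assumes nonneg: "\<And>t. t > 0 \<Longrightarrow> \<mu> t \<ge> 0" and l: "0 < l"
    and fin: "\<And>t::real. cumulative_rate \<mu> 0 (ereal t) < \<infinity>"
  shows "gap_integral l \<mu> = emeasure (diffuse_intensity.gap_intensity (rate_measure \<mu>) l) {0<..}"
proof -
  interpret diffuse_intensity "rate_measure \<mu>"
    by (rule diffuse_intensity_rate_measure[OF fin])
  have window: "enn2real (cumulative_rate \<mu> (ereal t) (ereal (t + l))) = measure (rate_measure \<mu>) {t<..t + l}"
    if "0 < t" for t
  proof -
    have "einterval (ereal t) (ereal (t + l)) = {t<..<t + l}" by (auto simp: einterval_def)
    then show ?thesis using that l
      by (simp add: cumulative_rate_eq measure_def[symmetric] measure_Ioo_eq_Ioc)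
  qed
  define w where "w t = ennreal (exp (- measure (rate_measure \<mu>) {t<..t + l}))" for t
  have w [measurable]: "w \<in> borel_measurable borel"
    unfolding w_def using window_measure_measurable[OF l] by simp
  have "emeasure (gap_intensity l) {0<..} = (\<integral>\<^sup>+t. w t * indicator {0<..} t \<partial>rate_measure \<mu>)"
    unfolding w_def by (rule emeasure_gap_intensity[OF l]) simp
  also have "\<dots> = (\<integral>\<^sup>+t. (ennreal (\<mu> t) * indicator {0<..} t) * (w t * indicator {0<..} t) \<partial>lborel)"
    unfolding rate_measure_def by (rule nn_integral_density) auto
  also have "\<dots> = gap_integral l \<mu>"
    unfolding gap_integral_def
    by (intro nn_integral_cong)
       (auto split: split_indicator simp: w_def window nonneg ennreal_mult mult.commute)
  finally show ?thesis ..
qed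

text \<open>Missing \<open>A\<close> means having count \<open>0\<close> in \<open>A \<inter> {0<..}\<close>, so the void probability is the case \<open>k = 0\<close> of
  the Poisson law.\<close>
lemma void_process_of_poisson:
  assumes ppp: "poisson_point_process P N \<mu>"
    and fin: "\<And>t::real. cumulative_rate \<mu> 0 (ereal t) < \<infinity>"
  shows "void_process P (rate_measure \<mu>) N"
proof -
  interpret diffuse_intensity "rate_measure \<mu>"
    by (rule diffuse_intensity_rate_measure[OF fin])
  have N: "\<And>\<omega>. \<omega> \<in> space P \<Longrightarrow> N \<omega> \<subseteq> {0<..}" "\<And>\<omega> t. \<omega> \<in> space P \<Longrightarrow> finite (N \<omega> \<inter> {..t})"
    and prob: "prob_space P"
    and count_measurable: "\<And>A. A \<in> sets (intensity_measure \<mu>) \<Longrightarrow>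
      (\<lambda>\<omega>. count_in (N \<omega>) A) \<in> borel_measurable P"
    using ppp by (simp_all add: poisson_point_process_def)
  have count_law: "measure P {\<omega>\<in>space P. count_in (N \<omega>) A = of_nat k} =
      measure (intensity_measure \<mu>) A ^ k / fact k * exp (- measure (intensity_measure \<mu>) A)"
    if "A \<in> sets (intensity_measure \<mu>)" "emeasure (intensity_measure \<mu>) A < \<infinity>" for A k
    using ppp that unfolding poisson_point_process_def by blast
  have count: "{\<omega> \<in> space P. N \<omega> \<inter> A = {}} = {\<omega> \<in> space P. count_in (N \<omega>) (A \<inter> {0<..}) = of_nat 0}" for A
    using N(1) by (auto simp: count_in_def emeasure_count_space_eq_0)
  interpret prob_space P by (rule prob)
  show ?thesis
  proof
    fix A :: "real set" assume A: "A \<in> sets borel" "bounded A"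
    note I = emeasure_intensity_measure[OF A(1)]
    have [measurable]: "(\<lambda>\<omega>. count_in (N \<omega>) (A \<inter> {0<..})) \<in> borel_measurable P"
      by (rule count_measurable[OF I(1)])
    show "{\<omega> \<in> space P. N \<omega> \<inter> A = {}} \<in> sets P" unfolding count by simp
    show "measure P {\<omega> \<in> space P. N \<omega> \<inter> A = {}} = exp (- measure (rate_measure \<mu>) A)"
    proof -
      have "measure (intensity_measure \<mu>) (A \<inter> {0<..}) = measure (rate_measure \<mu>) A"
        by (simp add: measure_def I(2))
      moreover have "emeasure (intensity_measure \<mu>) (A \<inter> {0<..}) < \<infinity>"
        using A by (simp add: I(2) emeasure_bounded)
      ultimately show ?thesis unfolding count by (subst count_law[OF I(1)]) auto
    qed
  qed (use N in auto)
qed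

end

theorem theorem3p1:
  fixes P :: "'w measure" and N :: "'w \<Rightarrow> real set" and \<mu> :: "real \<Rightarrow> real" and l :: real
  assumes "l > 0"
    and "\<mu> \<in> borel_measurable (restrict_space lborel {0<..})"
    and "\<And>t. t > 0 \<Longrightarrow> \<mu> t \<ge> 0"
    and "\<And>t::real. cumulative_rate \<mu> 0 (ereal t) < \<infinity>"
    and "AE t in lborel. t \<ge> 0 \<longrightarrow> \<mu> t > 0"
    and "poisson_point_process P N \<mu>"
  shows "(cumulative_rate \<mu> 0 \<infinity> < \<infinity> \<longrightarrow> (AE \<omega> in P. first_gap l (N \<omega>) < \<infinity>)) \<and>
         (cumulative_rate \<mu> 0 \<infinity> = \<infinity> \<longrightarrow>
            (gap_integral l \<mu> = \<infinity> \<longrightarrow> (AE \<omega> in P. first_gap l (N \<omega>) < \<infinity>)) \<and>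
            (gap_integral l \<mu> < \<infinity> \<longrightarrow>
               measure P {\<omega> \<in> space P. first_gap l (N \<omega>) = \<infinity>} > 0))"
proof -
  let ?\<Lambda> = "rate_measure \<mu>"
  interpret void_process P ?\<Lambda> N
    using assms by (intro void_process_of_poisson)
  have "einterval (ereal 0) \<infinity> = {0<..}" by (auto simp: einterval_def)
  then have total: "cumulative_rate \<mu> 0 \<infinity> = emeasure ?\<Lambda> {0<..}"
    using cumulative_rate_eq[OF assms(2), of 0 \<infinity>] by (simp add: zero_ereal_def)
  have gap: "gap_integral l \<mu> = emeasure (gap_intensity l) {0<..}"
    using assms by (intro gap_integral_eq)
  have pos: "0 < measure ?\<Lambda> {a<..b}" if "0 \<le> a" "a < b" for a b
    using rate_measure_pos[OF assms(2,5) that] by (simp add: emeasure_bounded)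
  have AE: "AE \<omega> in P. first_gap l (N \<omega>) < \<infinity>" if "prob (covered l UNIV) = 0"
  proof (rule AE_I)
    show "{\<omega> \<in> space P. \<not> first_gap l (N \<omega>) < \<infinity>} \<subseteq> covered l UNIV"
      unfolding first_gap_infinity_event[OF assms(1), symmetric] by auto
  qed (use that assms(1) in \<open>auto simp: emeasure_eq_measure intro: covered_events\<close>)
  show ?thesis
    using AE covered_null_finite[OF assms(1)] covered_null_infinite[OF assms(1)]
      covered_positive[OF assms(1) _ _ pos]
    unfolding total gap first_gap_infinity_event[OF assms(1)] by blast
qed

end
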